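(* Let $G$ and $H$ be weighted graphs on the same vertex set $V$, and let $H$ be a $\beta$-approximate emulator of $G$. Then any $\alpha$-approximate dual-only preconditioner for $H$ is an $(\alpha\cdot\beta)$-approximate dual-only preconditioner for $G$.
   Context: For a weighted undirected graph $G=(V,E)$ with $V=\{v_1,\dots,v_n\}$, orient edges as $\vec E=\{(v_i,v_j):\{v_i,v_j\}\in E,\ i<j\}$; the incidence matrix $B_G\in\{-1,0,1\}^{V\times\vec E}$ has, for $e=(s,t)$, entries $1$ at $s$, $-1$ at $t$, and $0$ elsewhere; $W_G$ is the diagonal matrix of the positive edge weights $w(e)\ge 1$. A demand $d\in\mathbb{R}^V$ is proper if $\sum_vd_v=0$; a flow $f\in\mathbb{R}^{\vec E}$ routes $d$ if $B_Gf=d$ and has cost $\|W_Gf\|_1$. An $\alpha$-approximate dual-only preconditioner for $G$ is a function mapping every proper demand $d$ to potentials $\phi\in\mathbb{R}^V$ such that $\|W_G^{-1}B_G^T\phi\|_\infty\le\alpha$ and there exists a flow $f$ in $G$ with $B_Gf=d$ and $\|W_Gf\|_1\le\langle d,\phi\rangle$. A weighted graph $H=(V,E_H)$ on the same vertex set is a $\beta$-approximate emulator of $G$ if $\mathrm{dist}_G(u,v)\le\mathrm{dist}_H(u,v)\le\beta\cdot\mathrm{dist}_G(u,v)$ for all $u,v\in V$, where $\mathrm{dist}$ denotes weighted shortest-path distance. *)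

theory Defs
  imports "HOL-Analysis.Analysis" "Graph_Theory.Graph_Theory"
begin

text \<open>The vertex set \<open>V\<close> is the universe of a finite, linearly ordered type \<open>'v\<close>; the linear order
  plays the role of the enumeration of \<open>V\<close>, so that \<open>\<real>\<^sup>V\<close> is \<open>real ^ 'v\<close>. Edges are unordered pairs
  of distinct vertices.\<close>

record 'v wgraph =
  edges :: "'v set set"
  weight :: "'v set \<Rightarrow> real"

definition weighted_graph :: "'v wgraph \<Rightarrow> bool" where
  "weighted_graph G \<longleftrightarrow> (\<forall>e \<in> edges G. card e = 2 \<and> weight G e \<ge> 1)"

definition arc_weight :: "'v wgraph \<Rightarrow> 'v \<times> 'v \<Rightarrow> real" where
  "arc_weight G a = weight G {fst a, snd a}"

subsection \<open>Distances\<close>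

definition sym_digraph_of :: "'v wgraph \<Rightarrow> 'v pair_pre_digraph" where
  "sym_digraph_of G = \<lparr> pverts = UNIV, parcs = {(u, v). {u, v} \<in> edges G} \<rparr>"

text \<open>Walks may use an edge in both directions. The infimum over no walks at all is \<open>\<infinity>\<close>, which is
  therefore the distance between vertices in different components.\<close>

definition gdist :: "'v wgraph \<Rightarrow> 'v \<Rightarrow> 'v \<Rightarrow> ereal" where
  "gdist G u v = wf_digraph.\<mu> (with_proj (sym_digraph_of G)) (arc_weight G) u v"

definition emulator :: "real \<Rightarrow> 'v wgraph \<Rightarrow> 'v wgraph \<Rightarrow> bool" where
  "emulator \<beta> H G \<longleftrightarrow>
     (\<forall>u v. gdist G u v \<le> gdist H u v \<and> gdist H u v \<le> ereal \<beta> * gdist G u v)"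

subsection \<open>Flows and potentials\<close>

text \<open>Vectors indexed by the oriented edges are functions on pairs, of which only the values on
  \<open>oriented_edges G\<close> are ever used.\<close>

definition oriented_edges :: "'v::linorder wgraph \<Rightarrow> ('v \<times> 'v) set" where
  "oriented_edges G = {(u, v). {u, v} \<in> edges G \<and> u < v}"

definition incidence :: "'v \<Rightarrow> 'v \<times> 'v \<Rightarrow> real" where
  "incidence v e = (if v = fst e then 1 else if v = snd e then -1 else 0)"

definition incidence_mult ::
    "'v::{finite,linorder} wgraph \<Rightarrow> ('v \<times> 'v \<Rightarrow> real) \<Rightarrow> real ^ 'v::{finite,linorder}" where
  "incidence_mult G f = (\<chi> v. \<Sum>e \<in> oriented_edges G. incidence v e * f e)"

definition incidence_transpose_mult ::
    "real ^ 'v::finite \<Rightarrow> 'v \<times> 'v \<Rightarrow> real" where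
  "incidence_transpose_mult \<phi> e = (\<Sum>v \<in> UNIV. incidence v e * \<phi> $ v)"

definition l1_norm_on :: "'i set \<Rightarrow> ('i \<Rightarrow> real) \<Rightarrow> real" where
  "l1_norm_on I x = (\<Sum>i \<in> I. \<bar>x i\<bar>)"

text \<open>Inserting \<open>0\<close> only matters for empty \<open>I\<close>, where the norm of the empty vector is \<open>0\<close>.\<close>

definition linf_norm_on :: "'i set \<Rightarrow> ('i \<Rightarrow> real) \<Rightarrow> real" where
  "linf_norm_on I x = Max (insert 0 ((\<lambda>i. \<bar>x i\<bar>) ` I))"

definition flow_cost :: "'v::linorder wgraph \<Rightarrow> ('v \<times> 'v \<Rightarrow> real) \<Rightarrow> real" where
  "flow_cost G f = l1_norm_on (oriented_edges G) (\<lambda>e. arc_weight G e * f e)"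

definition proper_demand :: "real ^ 'v::finite \<Rightarrow> bool" where
  "proper_demand d \<longleftrightarrow> (\<Sum>v \<in> UNIV. d $ v) = 0"

definition dual_only_preconditioner ::
    "real \<Rightarrow> 'v::{finite,linorder} wgraph \<Rightarrow> (real ^ 'v::{finite,linorder} \<Rightarrow> real ^ 'v::{finite,linorder}) \<Rightarrow> bool" where
  "dual_only_preconditioner \<alpha> G P \<longleftrightarrow>
     (\<forall>d. proper_demand d \<longrightarrow>
        linf_norm_on (oriented_edges G)
          (\<lambda>e. inverse (arc_weight G e) * incidence_transpose_mult (P d) e) \<le> \<alpha> \<and>
        (\<exists>f. incidence_mult G f = d \<and> flow_cost G f \<le> d \<bullet> P d))"

end

(* Along an edge {s, t} of G, a shortest s-t walk in H has length at most \<beta> w_G(s, t), and a potential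
   with slope at most \<alpha> on every edge of H changes by at most \<alpha> times the length of that walk.
   Conversely every edge {s, t} of H can be replaced by a shortest s-t walk in G of length at most
   w_H(s, t); so a flow in H reroutes to a flow in G of the same demand that does not cost more. *)
theory Submission
  imports Defs
begin

section \<open>Walks\<close>

lemma fin_digraph_sym_digraph_of:
  "fin_digraph (with_proj (sym_digraph_of (G :: 'v::finite wgraph)))"
  by unfold_locales (auto simp: sym_digraph_of_def intro: finite_subset[OF subset_UNIV])

lemma gdist_le_arc_weight:
  fixes G :: "'v::finite wgraph"
  assumes "{u, v} \<in> edges G"
  shows "gdist G u v \<le> ereal (arc_weight G (u, v))"
proof -
  interpret fin_digraph "with_proj (sym_digraph_of G)"
    by (rule fin_digraph_sym_digraph_of)
  have "awalk u [(u, v)] v"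
    using assms by (simp add: pre_digraph.awalk_def cas_with_proj_eq sym_digraph_of_def)
  from min_cost_le_walk_cost[OF this, of "arc_weight G"] show ?thesis
    by (simp add: gdist_def)
qed

text \<open>A real bound excludes the infimum over no walks, and with nonnegative weights on a
  finite digraph the infimum is attained by a path. The path is handed on as \<open>pcas\<close>
  with edge membership, a form suited to induction on the list.\<close>

lemma gdist_le_imp_walk:
  fixes G :: "'v::finite wgraph"
  assumes "weighted_graph G" and le: "gdist G u v \<le> ereal c"
  obtains p where "pcas u p v" and "\<And>x y. (x, y) \<in> set p \<Longrightarrow> {x, y} \<in> edges G"
    and "sum_list (map (arc_weight G) p) \<le> c"
proof -
  interpret fin_digraph "with_proj (sym_digraph_of G)"
    by (rule fin_digraph_sym_digraph_of)
  have "\<mu> (arc_weight G) u v < \<infinity>"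
    using le unfolding gdist_def by (auto intro: le_less_trans)
  hence reach: "u \<rightarrow>\<^sup>*\<^bsub>with_proj (sym_digraph_of G)\<^esub> v"
    by (simp only: \<mu>_reach_conv)
  have nonneg: "0 \<le> arc_weight G e" if "e \<in> arcs (with_proj (sym_digraph_of G))" for e
    using that assms(1) by (force simp: weighted_graph_def arc_weight_def sym_digraph_of_def)
  obtain p where p: "apath u p v" and cost: "\<mu> (arc_weight G) u v = awalk_cost (arc_weight G) p"
    using min_cost_awalk[OF reach, of "arc_weight G"] nonneg by blast
  show thesis
  proof
    show "pcas u p v"
      using p by (simp add: apath_def awalk_def cas_with_proj_eq)
    show "{x, y} \<in> edges G" if "(x, y) \<in> set p" for x y
      using p that by (auto simp: pre_digraph.apath_def pre_digraph.awalk_def sym_digraph_of_def)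
    show "sum_list (map (arc_weight G) p) \<le> c"
      using le cost by (simp add: gdist_def awalk_cost_def)
  qed
qed

text \<open>The difference telescopes along the walk, and the triangle inequality adds up the bounds
  of the single arcs.\<close>

lemma potential_diff_le_walk:
  fixes \<phi> :: "real ^ 'v::finite"
  assumes "pcas u p v" and "\<And>x y. (x, y) \<in> set p \<Longrightarrow> \<bar>\<phi> $ x - \<phi> $ y\<bar> \<le> \<alpha> * w (x, y)"
  shows "\<bar>\<phi> $ u - \<phi> $ v\<bar> \<le> \<alpha> * sum_list (map w p)"
  using assms
proof (induction p arbitrary: u)
  case (Cons a p)
  obtain x where a: "a = (u, x)"
    using Cons.prems(1) by (cases a) auto
  have "\<bar>\<phi> $ u - \<phi> $ x\<bar> \<le> \<alpha> * w (u, x)" "\<bar>\<phi> $ x - \<phi> $ v\<bar> \<le> \<alpha> * sum_list (map w p)"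
    using Cons a by auto
  thus ?case
    by (simp add: a distrib_left)
qed simp

section \<open>Potentials\<close>

lemma finite_oriented_edges [simp]:
  "finite (oriented_edges (G :: 'v::{finite,linorder} wgraph))"
  by (rule finite_subset[OF subset_UNIV]) simp

lemma linf_norm_on_le_iff:
  "finite I \<Longrightarrow> linf_norm_on I x \<le> c \<longleftrightarrow> 0 \<le> c \<and> (\<forall>i \<in> I. \<bar>x i\<bar> \<le> c)"
  by (simp add: linf_norm_on_def)

text \<open>The ends must differ: on a loop, \<open>incidence\<close> is 1 at the only vertex, and
  the sum would be \<open>\<phi> $ s\<close> instead of 0.\<close>

lemma incidence_transpose_mult_eq:
  fixes \<phi> :: "real ^ 'v::finite"
  assumes "s \<noteq> t"
  shows "incidence_transpose_mult \<phi> (s, t) = \<phi> $ s - \<phi> $ t"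
proof -
  have "incidence_transpose_mult \<phi> (s, t)
      = (\<Sum>v\<in>UNIV. (if v = s then \<phi> $ v else 0) - (if v = t then \<phi> $ v else 0))"
    unfolding incidence_transpose_mult_def
    by (rule sum.cong) (use assms in \<open>auto simp: incidence_def\<close>)
  thus ?thesis
    by (simp add: sum_subtractf)
qed

text \<open>Multiplying by the positive weights turns the norm bound into a Lipschitz condition on
  edges. The conjunct \<open>0 \<le> c\<close> comes from the 0 inserted in
  \<open>linf_norm_on\<close>.\<close>

lemma weighted_slope_le_iff:
  fixes G :: "'v::{finite,linorder} wgraph"
  assumes G: "weighted_graph G"
  shows "linf_norm_on (oriented_edges G)
      (\<lambda>e. inverse (arc_weight G e) * incidence_transpose_mult \<phi> e) \<le> c \<longleftrightarrow>
    0 \<le> c \<and> (\<forall>u v. {u, v} \<in> edges G \<longrightarrow> \<bar>\<phi> $ u - \<phi> $ v\<bar> \<le> c * arc_weight G (u, v))"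
    (is "?L \<longleftrightarrow> _ \<and> ?R")
proof -
  have w: "arc_weight G (u, v) > 0" if "{u, v} \<in> edges G" for u v
    using G that by (force simp: weighted_graph_def arc_weight_def)
  have loopfree: "u \<noteq> v" if "{u, v} \<in> edges G" for u v
    using G that by (force simp: weighted_graph_def)
  have "\<bar>inverse (arc_weight G (u, v)) * incidence_transpose_mult \<phi> (u, v)\<bar> \<le> c \<longleftrightarrow>
      \<bar>\<phi> $ u - \<phi> $ v\<bar> \<le> c * arc_weight G (u, v)" if "{u, v} \<in> edges G" for u v
    using w[OF that] loopfree[OF that]
    by (simp add: incidence_transpose_mult_eq abs_mult field_simps)
  hence "?L \<longleftrightarrow> 0 \<le> c \<and> (\<forall>u v. {u, v} \<in> edges G \<and> u < v \<longrightarrow>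
      \<bar>\<phi> $ u - \<phi> $ v\<bar> \<le> c * arc_weight G (u, v))"
    by (auto simp: linf_norm_on_le_iff oriented_edges_def)
  \<comment> \<open>Both sides of the bound are symmetric in \<open>u\<close> and \<open>v\<close>,
    so it extends from the chosen orientation to both.\<close>
  moreover have "(\<forall>u v. {u, v} \<in> edges G \<and> u < v \<longrightarrow>
      \<bar>\<phi> $ u - \<phi> $ v\<bar> \<le> c * arc_weight G (u, v)) \<longleftrightarrow> ?R"
  proof (intro iffI allI impI)
    fix u v
    assume *: "\<forall>u v. {u, v} \<in> edges G \<and> u < v \<longrightarrow> \<bar>\<phi> $ u - \<phi> $ v\<bar> \<le> c * arc_weight G (u, v)"
      and uv: "{u, v} \<in> edges G"
    show "\<bar>\<phi> $ u - \<phi> $ v\<bar> \<le> c * arc_weight G (u, v)"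
      using *[rule_format, of u v] *[rule_format, of v u] uv loopfree[OF uv]
      by (cases u v rule: linorder_cases) (auto simp: arc_weight_def insert_commute abs_minus_commute)
  qed auto
  ultimately show ?thesis
    by simp
qed

lemma slope_transfer:
  fixes G H :: "'v::{finite,linorder} wgraph" and \<phi> :: "real ^ 'v::{finite,linorder}"
  assumes H: "weighted_graph H" and "0 \<le> \<alpha>" and "0 \<le> \<beta>"
    and dist: "\<And>u v. gdist H u v \<le> ereal \<beta> * gdist G u v"
    and slope: "\<And>u v. {u, v} \<in> edges H \<Longrightarrow> \<bar>\<phi> $ u - \<phi> $ v\<bar> \<le> \<alpha> * arc_weight H (u, v)"
    and edge: "{u, v} \<in> edges G"
  shows "\<bar>\<phi> $ u - \<phi> $ v\<bar> \<le> \<alpha> * \<beta> * arc_weight G (u, v)"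
proof -
  have "gdist H u v \<le> ereal \<beta> * gdist G u v"
    by (rule dist)
  \<comment> \<open>An edge bounds its own distance by a real number; with
    \<open>0 \<le> \<beta>\<close> the distance in \<open>H\<close> is then finite and realised by a
    walk.\<close>
  also have "\<dots> \<le> ereal \<beta> * ereal (arc_weight G (u, v))"
    using gdist_le_arc_weight[OF edge] \<open>0 \<le> \<beta>\<close> by (intro ereal_mult_left_mono) auto
  finally have "gdist H u v \<le> ereal (\<beta> * arc_weight G (u, v))"
    by simp
  then obtain p where p: "pcas u p v" "\<And>x y. (x, y) \<in> set p \<Longrightarrow> {x, y} \<in> edges H"
    "sum_list (map (arc_weight H) p) \<le> \<beta> * arc_weight G (u, v)"
    using gdist_le_imp_walk[OF H] by blast
  have "\<bar>\<phi> $ u - \<phi> $ v\<bar> \<le> \<alpha> * sum_list (map (arc_weight H) p)"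
    using p(1) slope[OF p(2)] by (rule potential_diff_le_walk)
  also have "\<dots> \<le> \<alpha> * (\<beta> * arc_weight G (u, v))"
    using p(3) \<open>0 \<le> \<alpha>\<close> by (rule mult_left_mono)
  finally show ?thesis
    by (simp add: mult.assoc)
qed

section \<open>Flows\<close>

text \<open>Expansion in the columns of the incidence matrix, from which linearity in
  \<open>f\<close> is immediate. Oriented edges have distinct ends, so each column is a difference
  of two unit vectors.\<close>

lemma incidence_mult_eq_sum:
  fixes G :: "'v::{finite,linorder} wgraph"
  shows "incidence_mult G f = (\<Sum>e\<in>oriented_edges G. f e *\<^sub>R (axis (fst e) 1 - axis (snd e) 1))"
proof -
  have "incidence v e = axis (fst e) 1 $ v - axis (snd e) 1 $ v"
    if "e \<in> oriented_edges G" for v e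
    using that by (auto simp: oriented_edges_def incidence_def axis_def)
  thus ?thesis
    by (simp add: incidence_mult_def vec_eq_iff mult.commute)
qed

lemma incidence_mult_add:
  "incidence_mult G (\<lambda>a. f a + g a) = incidence_mult G f + incidence_mult G g"
  by (simp add: incidence_mult_eq_sum scaleR_left_distrib sum.distrib)

lemma incidence_mult_sum:
  "incidence_mult G (\<lambda>a. \<Sum>e\<in>A. c e * g e a) = (\<Sum>e\<in>A. c e *\<^sub>R incidence_mult G (g e))"
  unfolding incidence_mult_eq_sum scaleR_sum_left scaleR_sum_right
  by (subst sum.swap) simp

lemma incidence_mult_single:
  "e \<in> oriented_edges G \<Longrightarrow> incidence_mult G (\<lambda>a. if a = e then c else 0)
     = c *\<^sub>R (axis (fst e) 1 - axis (snd e) 1)"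
  by (simp add: incidence_mult_eq_sum if_distrib[of "\<lambda>x. x *\<^sub>R _"] cong: if_cong)

lemma flow_cost_add: "flow_cost G (\<lambda>a. f a + g a) \<le> flow_cost G f + flow_cost G g"
  unfolding flow_cost_def l1_norm_on_def sum.distrib[symmetric]
  by (intro sum_mono) (metis abs_triangle_ineq distrib_left)

text \<open>Triangle inequality for the weighted 1-norm; equality can fail because the flows
  \<open>g e\<close> may cancel on a shared edge.\<close>

lemma flow_cost_sum:
  "flow_cost G (\<lambda>a. \<Sum>e\<in>A. c e * g e a) \<le> (\<Sum>e\<in>A. \<bar>c e\<bar> * flow_cost G (g e))"
proof -
  have "flow_cost G (\<lambda>a. \<Sum>e\<in>A. c e * g e a)
      \<le> (\<Sum>a\<in>oriented_edges G. \<Sum>e\<in>A. \<bar>c e\<bar> * \<bar>arc_weight G a * g e a\<bar>)"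
    unfolding flow_cost_def l1_norm_on_def sum_distrib_left
    by (intro sum_mono order.trans[OF sum_abs]) (simp add: abs_mult mult_ac)
  also have "\<dots> = (\<Sum>e\<in>A. \<bar>c e\<bar> * flow_cost G (g e))"
    unfolding flow_cost_def l1_norm_on_def sum_distrib_left by (rule sum.swap)
  finally show ?thesis .
qed

lemma flow_cost_single:
  "e \<in> oriented_edges (G :: 'v::{finite,linorder} wgraph) \<Longrightarrow>
    flow_cost G (\<lambda>a. if a = e then c else 0) = \<bar>arc_weight G e * c\<bar>"
  by (simp add: flow_cost_def l1_norm_on_def if_distrib cong: if_cong)

lemma edge_flow:
  fixes G :: "'v::{finite,linorder} wgraph"
  assumes G: "weighted_graph G" and uv: "{u, v} \<in> edges G"
  obtains g where "incidence_mult G g = axis u 1 - axis v 1" and "flow_cost G g = arc_weight G (u, v)"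
proof -
  have w: "weight G {u, v} \<ge> 1" and "u \<noteq> v"
    using assms by (force simp: weighted_graph_def)+
  from \<open>u \<noteq> v\<close> consider "(u, v) \<in> oriented_edges G" | "(v, u) \<in> oriented_edges G"
    using uv by (auto simp: oriented_edges_def insert_commute elim: linorder_cases)
  thus thesis
  proof cases
    case e: 1
    show thesis
      by (rule that[of "\<lambda>a. if a = (u, v) then 1 else 0"])
        (use w in \<open>auto simp: incidence_mult_single[OF e] flow_cost_single[OF e] arc_weight_def\<close>)
  next
    \<comment> \<open>The edge is crossed against its orientation, so the unit of flow gets the sign
      -1; the weight belongs to the unordered pair and the cost is unchanged.\<close>
    case e: 2
    show thesis
      by (rule that[of "\<lambda>a. if a = (v, u) then -1 else 0"])
        (use w in \<open>auto simp: incidence_mult_single[OF e] flow_cost_single[OF e] arc_weight_def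
          insert_commute\<close>)
  qed
qed

text \<open>Unit flows on the successive arcs are added, and their demands cancel at the inner
  vertices. The cost is only bounded, since a walk may cross an edge in both directions.\<close>

lemma walk_flow:
  fixes G :: "'v::{finite,linorder} wgraph"
  assumes G: "weighted_graph G"
    and "pcas u p v" and "\<And>x y. (x, y) \<in> set p \<Longrightarrow> {x, y} \<in> edges G"
  shows "\<exists>g. incidence_mult G g = axis u 1 - axis v 1 \<and>
    flow_cost G g \<le> sum_list (map (arc_weight G) p)"
  using assms(2,3)
proof (induction p arbitrary: u)
  case Nil
  have "incidence_mult G (\<lambda>_. 0) = 0" "flow_cost G (\<lambda>_. 0) = 0"
    by (simp_all add: incidence_mult_eq_sum flow_cost_def l1_norm_on_def)
  with Nil show ?case
    by auto
next
  case (Cons a p)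
  obtain x where a: "a = (u, x)"
    using Cons.prems(1) by (cases a) auto
  obtain g where g: "incidence_mult G g = axis x 1 - axis v 1"
    "flow_cost G g \<le> sum_list (map (arc_weight G) p)"
    using Cons a by (metis list.set_intros(2) pcas.simps(2) snd_conv)
  obtain h where h: "incidence_mult G h = axis u 1 - axis x 1" "flow_cost G h = arc_weight G (u, x)"
    using edge_flow[OF G] Cons.prems(2) a by (metis list.set_intros(1))
  have "incidence_mult G (\<lambda>b. h b + g b) = axis u 1 - axis v 1"
    by (simp add: incidence_mult_add g(1) h(1))
  moreover have "flow_cost G (\<lambda>b. h b + g b) \<le> sum_list (map (arc_weight G) (a # p))"
    using flow_cost_add[of G h g] g(2) h(2) a by simp
  ultimately show ?case
    by blast
qed

lemma flow_transfer:
  fixes G H :: "'v::{finite,linorder} wgraph"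
  assumes G: "weighted_graph G" and H: "weighted_graph H"
    and dist: "\<And>u v. gdist G u v \<le> gdist H u v"
  shows "\<exists>f'. incidence_mult G f' = incidence_mult H f \<and> flow_cost G f' \<le> flow_cost H f"
proof -
  \<comment> \<open>A substitute in \<open>G\<close> for the single edge \<open>e\<close> of
    \<open>H\<close>: one unit sent along a walk that is no longer than the weight of
    \<open>e\<close>.\<close>
  have "\<exists>g. incidence_mult G g = axis (fst e) 1 - axis (snd e) 1 \<and> flow_cost G g \<le> arc_weight H e"
    if "e \<in> oriented_edges H" for e
  proof -
    have "gdist G (fst e) (snd e) \<le> ereal (arc_weight H e)"
      using order.trans[OF dist gdist_le_arc_weight] that by (auto simp: oriented_edges_def)
    then obtain p where "pcas (fst e) p (snd e)" "\<And>x y. (x, y) \<in> set p \<Longrightarrow> {x, y} \<in> edges G"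
      "sum_list (map (arc_weight G) p) \<le> arc_weight H e"
      using gdist_le_imp_walk[OF G] by blast
    thus ?thesis
      using walk_flow[OF G] by (meson order.trans)
  qed
  then obtain g where g: "\<And>e. e \<in> oriented_edges H \<Longrightarrow>
      incidence_mult G (g e) = axis (fst e) 1 - axis (snd e) 1"
    and cost: "\<And>e. e \<in> oriented_edges H \<Longrightarrow> flow_cost G (g e) \<le> arc_weight H e"
    by metis
  \<comment> \<open>The amount \<open>f e\<close>, of either sign, is sent through the substitute
    \<open>g e\<close>; linearity preserves the total demand.\<close>
  define f' where "f' = (\<lambda>a. \<Sum>e\<in>oriented_edges H. f e * g e a)"
  have "incidence_mult G f' = incidence_mult H f"
    unfolding f'_def incidence_mult_sum incidence_mult_eq_sum[of H f] by (simp add: g)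
  moreover have "flow_cost G f' \<le> flow_cost H f"
  proof -
    have "flow_cost G f' \<le> (\<Sum>e\<in>oriented_edges H. \<bar>f e\<bar> * flow_cost G (g e))"
      unfolding f'_def by (rule flow_cost_sum)
    \<comment> \<open>The absolute value around the weight matches \<open>flow_cost\<close>, which
      takes it of the whole product.\<close>
    also have "\<dots> \<le> (\<Sum>e\<in>oriented_edges H. \<bar>f e\<bar> * \<bar>arc_weight H e\<bar>)"
      using cost by (intro sum_mono mult_left_mono order.trans[OF cost abs_ge_self]) auto
    also have "\<dots> = flow_cost H f"
      by (simp add: flow_cost_def l1_norm_on_def abs_mult mult.commute)
    finally show ?thesis .
  qed
  ultimately show ?thesis
    by blast
qed

theorem theorem4p1:
  fixes G H :: "'v::{finite,linorder} wgraph"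
    and \<alpha> \<beta> :: real
    and P :: "real ^ 'v::{finite,linorder} \<Rightarrow> real ^ 'v::{finite,linorder}"
  assumes "weighted_graph G" and "weighted_graph H"
    and "0 \<le> \<beta>"
    and "emulator \<beta> H G"
    and "dual_only_preconditioner \<alpha> H P"
  shows "dual_only_preconditioner (\<alpha> * \<beta>) G P"
  unfolding dual_only_preconditioner_def weighted_slope_le_iff[OF assms(1)]
proof (intro allI impI conjI)
  fix d :: "real ^ 'v::{finite,linorder}" assume d: "proper_demand d"
  have lower: "gdist G u v \<le> gdist H u v" and upper: "gdist H u v \<le> ereal \<beta> * gdist G u v" for u v
    using assms(4) by (auto simp: emulator_def)
  \<comment> \<open>The sign of \<open>\<alpha>\<close> follows from the norm bound at
    \<open>d\<close>, as a norm is nonnegative.\<close>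
  have "0 \<le> \<alpha>" and slope: "\<And>u v. {u, v} \<in> edges H \<Longrightarrow> \<bar>P d $ u - P d $ v\<bar> \<le> \<alpha> * arc_weight H (u, v)"
    using assms(5) d by (auto simp: dual_only_preconditioner_def weighted_slope_le_iff[OF assms(2)])
  thus "0 \<le> \<alpha> * \<beta>"
    using assms(3) by simp
  show "\<bar>P d $ u - P d $ v\<bar> \<le> \<alpha> * \<beta> * arc_weight G (u, v)" if "{u, v} \<in> edges G" for u v
    using slope_transfer[OF assms(2) \<open>0 \<le> \<alpha>\<close> assms(3) upper slope that] .
  obtain f where f: "incidence_mult H f = d" "flow_cost H f \<le> d \<bullet> P d"
    using assms(5) d by (auto simp: dual_only_preconditioner_def)
  \<comment> \<open>The potentials \<open>P d\<close> are kept, so the bound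
    \<open>d \<bullet> P d\<close> is the same for both graphs and a rerouted flow of no greater
    cost meets it.\<close>
  show "\<exists>f. incidence_mult G f = d \<and> flow_cost G f \<le> d \<bullet> P d"
    using flow_transfer[OF assms(1,2) lower, of f] f by (metis order.trans)
qed

end
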